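(* Let $(\mathcal{H}_+;\mathcal{H}_0;\mathcal{H}_-)$ be a triplet of closely embedded Hilbert spaces. Then $(\mathcal{H}_-;\mathcal{H}_0;\mathcal{H}_+)$ is also a triplet of closely embedded Hilbert spaces. More precisely: (1) If $j_+$ and $j_-$ denote the closed embeddings of $\mathcal{H}_+$ in $\mathcal{H}_0$ and, respectively, of $\mathcal{H}_0$ in $\mathcal{H}_-$, then $j_-^{-1}$ and $j_+^{-1}$ are the closed embeddings of $\mathcal{H}_-$ in $\mathcal{H}_0$ and, respectively, of $\mathcal{H}_0$ in $\mathcal{H}_+$. (2) If $H$ and $A$ denote the Hamiltonian and, respectively, the kernel operator of the triplet $(\mathcal{H}_+;\mathcal{H}_0;\mathcal{H}_-)$, then $A$ and $H$ are the Hamiltonian and, respectively, the kernel operator of the triplet $(\mathcal{H}_-;\mathcal{H}_0;\mathcal{H}_+)$.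
   Context: All Hilbert spaces are complex, with inner products linear in the first variable; operators may be unbounded. For an injective operator $S$, $S^{-1}$ is its algebraic inverse, with $\operatorname{Dom}(S^{-1})=\operatorname{Ran}(S)$. A Hilbert space $\mathcal{K}$ is closely embedded in a Hilbert space $\mathcal{H}$ if there is a linear manifold $\mathcal{D}\subseteq\mathcal{K}\cap\mathcal{H}$ (on which the algebraic structures of $\mathcal{K}$ and $\mathcal{H}$ agree), dense in $\mathcal{K}$, such that the embedding operator $j$ with $\operatorname{Dom}(j)=\mathcal{D}$, $jx=x$, is closed as an operator from $\mathcal{K}$ to $\mathcal{H}$; $j$ is called the closed embedding. $(\mathcal{H}_+;\mathcal{H}_0;\mathcal{H}_-)$ is a triplet of closely embedded Hilbert spaces if: (th1) $\mathcal{H}_+$ is closely embedded in $\mathcal{H}_0$, with closed embedding $j_+$, and $\operatorname{Ran}(j_+)$ is dense in $\mathcal{H}_0$; (th2) $\mathcal{H}_0$ is closely embedded in $\mathcal{H}_-$, with closed embedding $j_-$, and $\operatorname{Ran}(j_-)$ is dense in $\mathcal{H}_-$; (th3) $\operatorname{Dom}(j_+^* )\subseteq\operatorname{Dom}(j_-)$ and for every $y\in\operatorname{Dom}(j_-)\subseteq\mathcal{H}_0$, $$\|y\|_-=\sup\Bigl\{\frac{|\langle x,y\rangle_{\mathcal{H}_0}|}{\|x\|_+}\;\Big|\; x\in\operatorname{Dom}(j_+),\ x\ne0\Bigr\}.$$ The kernel operator of the triplet is $A=j_+j_+^*$ (a one-to-one positive selfadjoint operator in $\mathcal{H}_0$),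 and its Hamiltonian is $H=A^{-1}$. *)

theory Defs
  imports
    "HOL-Analysis.Abstract_Metric_Spaces"
    "HOL-Library.Extended_Nonnegative_Real"
    "HOL-Algebra.Algebraic_Closure_Type"
begin

text \<open>
  Hilbert spaces are given by explicit carrier sets with their own operations, because
  the notion of closed embedding speaks about the intersection of two Hilbert spaces as sets.
  The vector space structure is that of an HOL-Algebra module over the field of complex
  numbers (the multiplicative fields \<^const>\<open>mult\<close> and \<^const>\<open>one\<close> that the module record
  inherits from rings play no role).
\<close>

abbreviation complex_ring :: "complex ring"
  where "complex_ring \<equiv> ring_of_type_algebra"

record 'a hspace = "(complex, 'a) module" +
  hinner :: "'a \<Rightarrow> 'a \<Rightarrow> complex"

definition hnorm :: "'a hspace \<Rightarrow> 'a \<Rightarrow> real"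
  where "hnorm H x = sqrt (Re (hinner H x x))"

text \<open>
  The locale \<^locale>\<open>Metric_space\<close> requires nonnegativity and symmetry of the distance also outside
  of the carrier, hence the default value.
\<close>

definition hdist :: "'a hspace \<Rightarrow> 'a \<Rightarrow> 'a \<Rightarrow> real"
  where "hdist H x y =
    (if x \<in> carrier H \<and> y \<in> carrier H then hnorm H (x \<ominus>\<^bsub>H\<^esub> y) else 0)"

abbreviation htopology :: "'a hspace \<Rightarrow> 'a topology"
  where "htopology H \<equiv> Metric_space.mtopology (carrier H) (hdist H)"

locale hilbert_space = module complex_ring H for H :: "'a hspace" (structure) +
  assumes hinner_add_left:
      "\<lbrakk>x \<in> carrier H; y \<in> carrier H; z \<in> carrier H\<rbrakk>
        \<Longrightarrow> hinner H (x \<oplus> y) z = hinner H x z + hinner H y z"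
    and hinner_smult_left:
      "\<lbrakk>x \<in> carrier H; y \<in> carrier H\<rbrakk> \<Longrightarrow> hinner H (c \<odot> x) y = c * hinner H x y"
    and hinner_commute:
      "\<lbrakk>x \<in> carrier H; y \<in> carrier H\<rbrakk> \<Longrightarrow> hinner H y x = cnj (hinner H x y)"
    and hinner_nonneg:
      "x \<in> carrier H \<Longrightarrow> Re (hinner H x x) \<ge> 0"
    and hinner_eq_zero:
      "\<lbrakk>x \<in> carrier H; hinner H x x = 0\<rbrakk> \<Longrightarrow> x = \<zero>"
    and complete:
      "Metric_space.mcomplete (carrier H) (hdist H)"

definition dense_in :: "'a hspace \<Rightarrow> 'a set \<Rightarrow> bool"
  where "dense_in H D \<longleftrightarrow> D \<subseteq> carrier H \<and> htopology H closure_of D = carrier H"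

text \<open>
  Unbounded operators are represented by their graphs: \<^term>\<open>(x, y) \<in> T\<close> means that
  \<^term>\<open>x\<close> is in the domain of \<^term>\<open>T\<close> and is mapped to \<^term>\<open>y\<close>. Domain and range
  are \<^const>\<open>Domain\<close> and \<^const>\<open>Range\<close>, the algebraic inverse of an injective operator is
  the converse relation, and the operator product \<open>S T\<close> is the relation \<^term>\<open>T O S\<close>.
\<close>

definition closed_operator :: "'a hspace \<Rightarrow> 'a hspace \<Rightarrow> 'a rel \<Rightarrow> bool"
  where "closed_operator K H T \<longleftrightarrow> closedin (prod_topology (htopology K) (htopology H)) T"

text \<open>The adjoint, an operator from \<open>H\<close> to \<open>K\<close>, of a densely defined operator from \<open>K\<close> to \<open>H\<close>.\<close>

definition adjoint :: "'a hspace \<Rightarrow> 'a hspace \<Rightarrow> 'a rel \<Rightarrow> 'a rel"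
  where "adjoint K H T =
    {(y, z). y \<in> carrier H \<and> z \<in> carrier K \<and>
             (\<forall>(x, w) \<in> T. hinner H w y = hinner K x z)}"

definition same_linear_structure_on :: "'a set \<Rightarrow> 'a hspace \<Rightarrow> 'a hspace \<Rightarrow> bool"
  where "same_linear_structure_on D K H \<longleftrightarrow>
    \<zero>\<^bsub>K\<^esub> = \<zero>\<^bsub>H\<^esub> \<and>
    (\<forall>x\<in>D. \<forall>y\<in>D. x \<oplus>\<^bsub>K\<^esub> y = x \<oplus>\<^bsub>H\<^esub> y) \<and>
    (\<forall>c. \<forall>x\<in>D. c \<odot>\<^bsub>K\<^esub> x = c \<odot>\<^bsub>H\<^esub> x)"

text \<open>\<open>j\<close> is a closed embedding of \<open>K\<close> in \<open>H\<close>.\<close>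

definition closed_embedding :: "'a hspace \<Rightarrow> 'a hspace \<Rightarrow> 'a rel \<Rightarrow> bool"
  where "closed_embedding K H j \<longleftrightarrow>
    hilbert_space K \<and> hilbert_space H \<and>
    (\<exists>D. D \<subseteq> carrier K \<inter> carrier H \<and>
         submodule D complex_ring K \<and> submodule D complex_ring H \<and>
         same_linear_structure_on D K H \<and>
         dense_in K D \<and>
         j = Id_on D \<and>
         closed_operator K H j)"

text \<open>
  The supremum in the third condition is taken in the extended nonnegative reals: the equation
  contains the assertion that it is finite, and the supremum is \<open>0\<close> if all spaces are trivial.
\<close>

definition triplet_with ::
    "'a hspace \<Rightarrow> 'a hspace \<Rightarrow> 'a hspace \<Rightarrow> 'a rel \<Rightarrow> 'a rel \<Rightarrow> bool"
  where "triplet_with Hp H0 Hm jp jm \<longleftrightarrow>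
    closed_embedding Hp H0 jp \<and> dense_in H0 (Range jp) \<and>
    closed_embedding H0 Hm jm \<and> dense_in Hm (Range jm) \<and>
    Domain (adjoint Hp H0 jp) \<subseteq> Domain jm \<and>
    (\<forall>y \<in> Domain jm. ennreal (hnorm Hm y) =
       (SUP x \<in> Domain jp - {\<zero>\<^bsub>Hp\<^esub>}. ennreal (cmod (hinner H0 x y) / hnorm Hp x)))"

definition triplet :: "'a hspace \<Rightarrow> 'a hspace \<Rightarrow> 'a hspace \<Rightarrow> bool"
  where "triplet Hp H0 Hm \<longleftrightarrow> (\<exists>jp jm. triplet_with Hp H0 Hm jp jm)"

definition kernel_operator :: "'a hspace \<Rightarrow> 'a hspace \<Rightarrow> 'a rel \<Rightarrow> 'a rel"
  where "kernel_operator Hp H0 jp = adjoint Hp H0 jp O jp"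

definition hamiltonian :: "'a hspace \<Rightarrow> 'a hspace \<Rightarrow> 'a rel \<Rightarrow> 'a rel"
  where "hamiltonian Hp H0 jp = (kernel_operator Hp H0 jp)\<inverse>"

end

theory Submission
  imports Defs
begin

text \<open>
  The third triplet condition forces \<open>Dom(j\<^sub>+\<^sup>*) = Dom(j\<^sub>-)\<close> by the Riesz theorem, and says that
  \<open>T = j\<^sub>+\<^sup>*\<close> is isometric from the norm of \<open>H\<^sub>-\<close> to that of \<open>H\<^sub>+\<close>. By polarization
  \<open>\<langle>x, x'\<rangle>\<^sub>- = \<langle>T x, T x'\<rangle>\<^sub>+\<close>. Since \<open>j\<^sub>+\<close> is closed and injective, \<open>j\<^sub>+\<^sup>*\<^sup>* = j\<^sub>+\<close> and \<open>T\<close> has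
  dense range. So \<open>T\<close> transports every statement about \<open>(j\<^sub>-\<^sup>-\<^sup>1)\<^sup>*\<close> and the norm of \<open>H\<^sub>-\<close> to one about
  \<open>H\<^sub>+\<close>, where it follows from \<open>\<langle>x, y\<rangle>\<^sub>0 = \<langle>T x, y\<rangle>\<^sub>+\<close> for \<open>y \<in> Dom(j\<^sub>+)\<close>.
\<close>

subsection \<open>Semi-inner product spaces\<close>

lemma complex_ring_simps [simp]:
  "carrier complex_ring = UNIV" "a \<oplus>\<^bsub>complex_ring\<^esub> b = a + b" "a \<otimes>\<^bsub>complex_ring\<^esub> b = a * b"
  "\<one>\<^bsub>complex_ring\<^esub> = 1" "\<zero>\<^bsub>complex_ring\<^esub> = 0"
  by (simp_all add: ring_of_type_algebra_def)

text \<open>Definiteness and completeness are left out so that the Riesz argument can be run on a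
  submodule of a Hilbert space, and on the domain of an embedding under the graph inner
  product.\<close>

locale semi_inner_space = module complex_ring H for H :: "'a hspace" (structure) +
  assumes ip_add_left:
      "\<lbrakk>x \<in> carrier H; y \<in> carrier H; z \<in> carrier H\<rbrakk>
        \<Longrightarrow> hinner H (x \<oplus> y) z = hinner H x z + hinner H y z"
    and ip_smult_left:
      "\<lbrakk>x \<in> carrier H; y \<in> carrier H\<rbrakk> \<Longrightarrow> hinner H (c \<odot> x) y = c * hinner H x y"
    and ip_commute:
      "\<lbrakk>x \<in> carrier H; y \<in> carrier H\<rbrakk> \<Longrightarrow> hinner H y x = cnj (hinner H x y)"
    and ip_nonneg:
      "x \<in> carrier H \<Longrightarrow> Re (hinner H x x) \<ge> 0"
begin

section \<open>Sesquilinearity, the norm and its inequalities\<close>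

lemma smult_mem [simp]: "x \<in> carrier H \<Longrightarrow> c \<odot> x \<in> carrier H"
  by (rule smult_closed) simp_all

lemma ip_add_right:
  "\<lbrakk>x \<in> carrier H; y \<in> carrier H; z \<in> carrier H\<rbrakk>
    \<Longrightarrow> hinner H z (x \<oplus> y) = hinner H z x + hinner H z y"
  using ip_add_left[of x y z] ip_commute[of z "x \<oplus> y"] ip_commute[of z x] ip_commute[of z y]
  by (metis M.add.m_closed complex_cnj_add complex_cnj_cnj)

lemma ip_smult_right:
  "\<lbrakk>x \<in> carrier H; y \<in> carrier H\<rbrakk> \<Longrightarrow> hinner H y (c \<odot> x) = cnj c * hinner H y x"
  using ip_smult_left[of x y c] ip_commute[of y x] ip_commute[of y "c \<odot> x"]
  by (metis complex_cnj_cnj complex_cnj_mult smult_mem)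

lemma ip_self: "x \<in> carrier H \<Longrightarrow> hinner H x x = of_real ((hnorm H x)\<^sup>2)"
  using ip_nonneg[of x] ip_commute[of x x]
  by (auto simp: hnorm_def complex_eq_iff)

lemma hnorm_nonneg [simp]: "x \<in> carrier H \<Longrightarrow> hnorm H x \<ge> 0"
  by (simp add: hnorm_def ip_nonneg)

lemma hnorm_square: "x \<in> carrier H \<Longrightarrow> (hnorm H x)\<^sup>2 = Re (hinner H x x)"
  by (simp add: hnorm_def ip_nonneg)

text \<open>The one expansion behind Cauchy-Schwarz, the triangle inequality, the parallelogram law
  and, for triplets, polarization.\<close>

lemma hnorm_square_add_smult:
  assumes "x \<in> carrier H" "y \<in> carrier H"
  shows "(hnorm H (x \<oplus> c \<odot> y))\<^sup>2 =
    (hnorm H x)\<^sup>2 + 2 * Re (cnj c * hinner H x y) + (cmod c)\<^sup>2 * (hnorm H y)\<^sup>2"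
proof -
  have "hinner H (x \<oplus> c \<odot> y) (x \<oplus> c \<odot> y) = hinner H x x + cnj c * hinner H x y
     + c * cnj (hinner H x y) + c * cnj c * hinner H y y"
    using assms ip_commute[of x y]
    by (simp add: ip_add_left ip_add_right ip_smult_left ip_smult_right algebra_simps)
  moreover have "Re (c * cnj (hinner H x y)) = Re (cnj c * hinner H x y)"
    by simp
  moreover have "Re (c * cnj c * hinner H y y) = (cmod c)\<^sup>2 * (hnorm H y)\<^sup>2"
    using assms by (simp add: ip_self complex_norm_square[symmetric] flip: of_real_power of_real_mult)
  ultimately show ?thesis
    using assms by (simp add: hnorm_square del: complex_cnj_mult)
qed

lemma hnorm_smult: "x \<in> carrier H \<Longrightarrow> hnorm H (c \<odot> x) = cmod c * hnorm H x"
proof -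
  assume x: "x \<in> carrier H"
  have "hinner H (c \<odot> x) (c \<odot> x) = c * cnj c * hinner H x x"
    using x by (simp add: ip_smult_left ip_smult_right)
  also have "\<dots> = of_real ((cmod c * hnorm H x)\<^sup>2)"
    by (simp add: ip_self[OF x] power_mult_distrib flip: complex_norm_square)
  finally have "(hnorm H (c \<odot> x))\<^sup>2 = (cmod c * hnorm H x)\<^sup>2"
    using x by (simp add: hnorm_square flip: of_real_power)
  then show ?thesis
    using x by (simp add: power2_eq_iff_nonneg)
qed

lemma cauchy_schwarz:
  assumes x: "x \<in> carrier H" and y: "y \<in> carrier H"
  shows "cmod (hinner H x y) \<le> hnorm H x * hnorm H y"
proof -
  define a where "a = hinner H x y"
  \<comment> \<open>Moving \<open>x\<close> along \<open>y\<close> by a real multiple of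
    \<open>a\<close> makes the cross term real: the result is a nonnegative quadratic in
    \<open>t\<close>.\<close>
  have *: "0 \<le> (hnorm H x)\<^sup>2 - 2 * t * (cmod a)\<^sup>2 + t\<^sup>2 * (cmod a)\<^sup>2 * (hnorm H y)\<^sup>2" for t :: real
  proof -
    have "0 \<le> (hnorm H (x \<oplus> (- t * a) \<odot> y))\<^sup>2"
      by simp
    also have "\<dots> = (hnorm H x)\<^sup>2 + 2 * Re (cnj (- t * a) * a) + (cmod (- t * a))\<^sup>2 * (hnorm H y)\<^sup>2"
      using hnorm_square_add_smult[OF x y, of "- t * a"] by (simp add: a_def)
    also have "Re (cnj (- t * a) * a) = - t * (cmod a)\<^sup>2"
      by (simp add: cmod_power2 power2_eq_square[of "Re a"] power2_eq_square[of "Im a"] algebra_simps)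
    finally show ?thesis
      by (simp add: norm_mult power_mult_distrib)
  qed
  have "(cmod a)\<^sup>2 \<le> (hnorm H x)\<^sup>2 * (hnorm H y)\<^sup>2"
  proof (cases "hnorm H y = 0")
    case True
    have "a = 0"
    proof (rule ccontr)
      assume "a \<noteq> 0"
      then show False
        \<comment> \<open>The quadratic degenerates to an affine function of \<open>t\<close>; at
          this \<open>t\<close> its value is at most -2.\<close>
        using *[of "((hnorm H x)\<^sup>2 + 1) / (cmod a)\<^sup>2"] True zero_le_power2[of "hnorm H x"]
        by simp
    qed
    then show ?thesis by simp
  next
    case False
    define Y where "Y = (hnorm H y)\<^sup>2"
    have Y: "Y > 0"
      using False by (simp add: Y_def)
    then show ?thesis
      \<comment> \<open>The minimum of the quadratic is at \<open>t = 1 / Y\<close>.\<close>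
      using *[of "1 / Y"] unfolding Y_def[symmetric]
      by (simp add: field_simps power2_eq_square[of Y])
  qed
  then show ?thesis
    using x y by (simp add: a_def flip: power_mult_distrib)
qed

lemma hnorm_triangle:
  assumes "x \<in> carrier H" "y \<in> carrier H"
  shows "hnorm H (x \<oplus> y) \<le> hnorm H x + hnorm H y"
proof -
  have "(hnorm H (x \<oplus> 1 \<odot> y))\<^sup>2 \<le> (hnorm H x + hnorm H y)\<^sup>2"
    using hnorm_square_add_smult[OF assms, of 1] cauchy_schwarz[OF assms]
      complex_Re_le_cmod[of "hinner H x y"]
    by (simp add: power2_sum)
  then show ?thesis
    using assms smult_one[of y] by (simp add: power2_le_iff_abs_le)
qed

text \<open>
  Riesz representation without completeness: a sequence that minimizes
  \<open>\<parallel>x\<parallel>\<^sup>2 - 2 Re (f x)\<close> is Cauchy by the parallelogram law, and a variation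
  \<open>x + t y\<close> shows that it represents \<open>f\<close> in the limit.
\<close>

lemma riesz_sequence:
  assumes f_add: "\<And>x y. \<lbrakk>x \<in> carrier H; y \<in> carrier H\<rbrakk> \<Longrightarrow> f (x \<oplus> y) = f x + f y"
    and f_smult: "\<And>c x. x \<in> carrier H \<Longrightarrow> f (c \<odot> x) = c * f x"
    and f_bound: "\<And>x. x \<in> carrier H \<Longrightarrow> cmod (f x) \<le> C * hnorm H x"
  obtains s where "\<And>n. s n \<in> carrier H"
    and "\<And>e. e > 0 \<Longrightarrow> \<exists>N. \<forall>m\<ge>N. \<forall>n\<ge>N. hnorm H (s m \<oplus> (-1) \<odot> s n) < e"
    and "\<And>x. x \<in> carrier H \<Longrightarrow> (\<lambda>n. hinner H x (s n)) \<longlonglongrightarrow> f x"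
proof -
  define J where "J x = (hnorm H x)\<^sup>2 - 2 * Re (f x)" for x
  \<comment> \<open>Completing the square: \<open>J x\<close> is at least
    \<open>(hnorm H x - C)\<^sup>2 - C\<^sup>2\<close>.\<close>
  have J_ge: "J x \<ge> - C\<^sup>2" if "x \<in> carrier H" for x
  proof -
    have "Re (f x) \<le> C * hnorm H x"
      using f_bound[OF that] complex_Re_le_cmod[of "f x"] by linarith
    moreover have "0 \<le> (hnorm H x - C)\<^sup>2" by simp
    ultimately show ?thesis
      by (simp add: J_def power2_diff algebra_simps)
  qed
  define I where "I = Inf (J ` carrier H)"
  have ne: "J ` carrier H \<noteq> {}" by blast
  have bdd: "bdd_below (J ` carrier H)"
    using J_ge by (auto intro!: bdd_belowI)
  have I_le: "I \<le> J x" if "x \<in> carrier H" for x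
    unfolding I_def using bdd that by (simp add: cInf_lower)
  have "\<exists>x\<in>carrier H. J x < I + inverse (real (Suc n))" for n
    using cInf_lessD[OF ne, of "I + inverse (real (Suc n))"] by (auto simp: I_def)
  then obtain s where s: "\<And>n. s n \<in> carrier H"
    and J_s: "\<And>n. J (s n) < I + inverse (real (Suc n))"
    by metis
  have J_add: "J (x \<oplus> c \<odot> y) = J x + 2 * Re (cnj c * hinner H x y) - 2 * Re (c * f y)
      + (cmod c)\<^sup>2 * (hnorm H y)\<^sup>2" if "x \<in> carrier H" "y \<in> carrier H" for x y c
    using that hnorm_square_add_smult[OF that, of c] by (simp add: J_def f_add f_smult)

  have cauchy: "\<exists>N. \<forall>m\<ge>N. \<forall>n\<ge>N. hnorm H (s m \<oplus> (-1) \<odot> s n) < e" if e: "e > 0" for e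
  proof -
    \<comment> \<open>By the parallelogram identity the squared distance is at most twice the sum of
      the two excesses over \<open>I\<close>, and each excess is below a quarter of
      \<open>e\<^sup>2\<close>.\<close>
    obtain N where N: "inverse (real (Suc N)) < e\<^sup>2 / 4"
      using reals_Archimedean[of "e\<^sup>2 / 4"] e by auto
    have "hnorm H (s m \<oplus> (-1) \<odot> s n) < e" if mn: "m \<ge> N" "n \<ge> N" for m n
    proof -
      have le: "inverse (real (Suc m)) \<le> inverse (real (Suc N))"
        "inverse (real (Suc n)) \<le> inverse (real (Suc N))"
        using mn by (simp_all add: field_simps)
      \<comment> \<open>The parallelogram law; the terms linear in \<open>f\<close> cancel because
        the midpoint takes half of each.\<close>
      have par: "(hnorm H (x \<oplus> (-1) \<odot> y))\<^sup>2 = 2 * J x + 2 * J y - 4 * J ((1/2) \<odot> x \<oplus> (1/2) \<odot> y)"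
        if "x \<in> carrier H" "y \<in> carrier H" for x y
      proof -
        have "J ((1/2) \<odot> x \<oplus> (1/2) \<odot> y) =
          (hnorm H x)\<^sup>2 / 4 + Re (hinner H x y) / 2 + (hnorm H y)\<^sup>2 / 4 - Re (f x) - Re (f y)"
          using that hnorm_square_add_smult[of "(1/2) \<odot> x" y "1/2"]
          by (simp add: J_def f_add f_smult hnorm_smult power_mult_distrib ip_smult_left
              power2_eq_square norm_divide)
        then show ?thesis
          using hnorm_square_add_smult[OF that, of "-1"] by (simp add: J_def)
      qed
      have "(hnorm H (s m \<oplus> (-1) \<odot> s n))\<^sup>2 \<le> 2 * J (s m) + 2 * J (s n) - 4 * I"
        using par[OF s[of m] s[of n]] I_le[of "(1/2) \<odot> s m \<oplus> (1/2) \<odot> s n"] s by simp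
      also have "\<dots> < e\<^sup>2"
        using J_s[of m] J_s[of n] le N by linarith
      finally show ?thesis
        using e by (simp add: power2_less_imp_less)
    qed
    then show ?thesis by blast
  qed

  have weak: "(\<lambda>n. Re (hinner H x (s n))) \<longlonglongrightarrow> Re (f x)" if x: "x \<in> carrier H" for x
  proof -
    \<comment> \<open>The added 1 keeps the denominator positive when \<open>x\<close> has norm
      0.\<close>
    define Q where "Q = (hnorm H x)\<^sup>2 + 1"
    have Q: "Q > 0" by (simp add: Q_def add_nonneg_pos)
    have "(Re (hinner H x (s n)) - Re (f x))\<^sup>2 \<le> Q * inverse (real (Suc n))" for n
    proof -
      define b where "b = Re (hinner H x (s n)) - Re (f x)"
      \<comment> \<open>This \<open>t\<close> minimizes \<open>2 * t * b + t\<^sup>2 * Q\<close>. As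
        \<open>s n\<close> is within \<open>1 / (n + 1)\<close> of the infimum, the resulting
        decrease \<open>b\<^sup>2 / Q\<close> cannot exceed that gap.\<close>
      define t where "t = - b / Q"
      have "Re (hinner H (s n) x) = Re (hinner H x (s n))"
        using ip_commute[OF x s[of n]] by simp
      then have "J (s n \<oplus> complex_of_real t \<odot> x) = J (s n) + 2 * t * b + t\<^sup>2 * (hnorm H x)\<^sup>2"
        using J_add[OF s[of n] x, of "complex_of_real t"]
        by (simp add: b_def algebra_simps)
      then have "0 \<le> J (s n) - I + 2 * t * b + t\<^sup>2 * (hnorm H x)\<^sup>2"
        using I_le[of "s n \<oplus> complex_of_real t \<odot> x"] s x by simp
      also have "\<dots> \<le> inverse (real (Suc n)) + (2 * t * b + t\<^sup>2 * Q)"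
        using J_s[of n] zero_le_power2[of t] unfolding Q_def distrib_left by linarith
      also have "2 * t * b + t\<^sup>2 * Q = - (b\<^sup>2 / Q)"
        using Q by (simp add: t_def field_simps power2_eq_square)
      finally have "b\<^sup>2 / Q \<le> inverse (real (Suc n))"
        by simp
      then show ?thesis
        using Q unfolding b_def[symmetric] by (simp add: pos_divide_le_eq mult.commute)
    qed
    moreover have "(\<lambda>n. Q * inverse (real (Suc n))) \<longlonglongrightarrow> Q * 0"
      by (intro tendsto_intros LIMSEQ_inverse_real_of_nat)
    ultimately have "(\<lambda>n. (Re (hinner H x (s n)) - Re (f x))\<^sup>2) \<longlonglongrightarrow> 0"
      by (intro tendsto_sandwich[of "\<lambda>_. 0" "\<lambda>n. (Re (hinner H x (s n)) - Re (f x))\<^sup>2" sequentially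
            "\<lambda>n. Q * inverse (real (Suc n))" 0]) auto
    then have "(\<lambda>n. Re (hinner H x (s n)) - Re (f x)) \<longlonglongrightarrow> 0"
      by simp
    then show ?thesis
      by (simp add: LIM_zero_iff)
  qed
  have "(\<lambda>n. hinner H x (s n)) \<longlonglongrightarrow> f x" if x: "x \<in> carrier H" for x
    \<comment> \<open>Real parts at \<open>\<i> \<odot> x\<close> are the negated imaginary parts at
      \<open>x\<close>.\<close>
    using weak[OF x] weak[of "\<i> \<odot> x"] x s
    by (simp add: tendsto_complex_iff f_smult ip_smult_left)
       (simp add: tendsto_minus_cancel_left[symmetric])
  then show ?thesis
    using that s cauchy by blast
qed

end

subsection \<open>Hilbert spaces\<close>

sublocale hilbert_space \<subseteq> semi_inner_space H
  by unfold_locales (fact hinner_add_left hinner_smult_left hinner_commute hinner_nonneg)+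

context hilbert_space
begin

lemma minus_eq_smult: "y \<in> carrier H \<Longrightarrow> \<ominus> y = (-1) \<odot> y"
proof -
  assume y: "y \<in> carrier H"
  have "(-1) \<odot> y \<oplus> y = ((-1) + 1) \<odot> y"
    using smult_l_distr[of "-1" 1 y] smult_one[OF y] y by simp
  also have "\<dots> = \<zero>"
    using smult_l_null[OF y] by simp
  finally show ?thesis
    using y by (intro M.minus_equality) auto
qed

lemma hnorm_eq_zero_iff: "x \<in> carrier H \<Longrightarrow> hnorm H x = 0 \<longleftrightarrow> x = \<zero>"
proof
  assume "x \<in> carrier H" "hnorm H x = 0"
  then show "x = \<zero>"
    by (intro hinner_eq_zero) (simp_all add: ip_self)
next
  assume x: "x \<in> carrier H" "x = \<zero>"
  have "hnorm H (0 \<odot> x) = 0"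
    using hnorm_smult[OF x(1), of 0] by simp
  then show "hnorm H x = 0"
    using x smult_l_null[OF x(1)] by simp
qed

lemma eq_if_hnorm_diff_eq_zero:
  assumes "x \<in> carrier H" "y \<in> carrier H" "hnorm H (x \<oplus> (-1) \<odot> y) = 0"
  shows "x = y"
  using assms by (simp add: hnorm_eq_zero_iff flip: minus_eq_smult)
    (metis M.add.inv_closed M.add.inv_equality M.minus_minus)

section \<open>The metric of the norm and continuity along convergent sequences\<close>

lemma hdist_eq:
  "x \<in> carrier H \<Longrightarrow> y \<in> carrier H \<Longrightarrow> hdist H x y = hnorm H (x \<oplus> (-1) \<odot> y)"
  by (simp add: hdist_def a_minus_def minus_eq_smult)

sublocale metric: Metric_space "carrier H" "hdist H"
proof
  show "0 \<le> hdist H x y" for x y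
    by (simp add: hdist_def)
  show "hdist H x y = hdist H y x" for x y
  proof (cases "x \<in> carrier H \<and> y \<in> carrier H")
    case True
    then have "(-1) \<odot> (y \<oplus> (-1) \<odot> x) = x \<oplus> (-1) \<odot> y"
      by (simp add: minus_eq_smult[symmetric] M.minus_add M.a_comm)
    then show ?thesis
      using True hnorm_smult[of "y \<oplus> (-1) \<odot> x" "-1"] by (simp add: hdist_eq)
  qed (auto simp: hdist_def)
  show "hdist H x y = 0 \<longleftrightarrow> x = y" if "x \<in> carrier H" "y \<in> carrier H" for x y
    using that eq_if_hnorm_diff_eq_zero[of x y] hnorm_eq_zero_iff[of \<zero>]
    by (auto simp: hdist_def a_minus_def minus_eq_smult[symmetric] M.r_neg)
  show "hdist H x z \<le> hdist H x y + hdist H y z"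
    if xyz: "x \<in> carrier H" "y \<in> carrier H" "z \<in> carrier H" for x y z
  proof -
    have "(x \<oplus> \<ominus> y) \<oplus> (y \<oplus> \<ominus> z) = x \<oplus> \<ominus> z"
      using xyz by (metis M.a_assoc M.a_closed M.a_inv_closed M.l_neg M.l_zero)
    then show ?thesis
      using xyz hnorm_triangle[of "x \<oplus> \<ominus> y" "y \<oplus> \<ominus> z"] by (simp add: hdist_def a_minus_def)
  qed
qed

lemma Cauchy_imp_limit:
  assumes "\<And>n. s n \<in> carrier H"
    and "\<And>e. e > 0 \<Longrightarrow> \<exists>N. \<forall>m\<ge>N. \<forall>n\<ge>N. hnorm H (s m \<oplus> (-1) \<odot> s n) < e"
  obtains l where "l \<in> carrier H" "limitin (htopology H) s l sequentially"
proof -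
  have "metric.MCauchy s"
    unfolding metric.MCauchy_def using assms by (auto simp: hdist_eq)
  then show ?thesis
    using complete that unfolding metric.mcomplete_def by (metis metric.limitin_mspace)
qed

lemma limit_imp_Cauchy:
  assumes "\<And>n. s n \<in> carrier H" and "limitin (htopology H) s l sequentially" and "e > 0"
  shows "\<exists>N. \<forall>m\<ge>N. \<forall>n\<ge>N. hnorm H (s m \<oplus> (-1) \<odot> s n) < e"
proof -
  have "metric.MCauchy s"
    using assms by (intro metric.convergent_imp_MCauchy) auto
  then show ?thesis
    unfolding metric.MCauchy_def using assms(1,3) by (simp add: hdist_eq)
qed

lemma hdist_limit:
  assumes "\<And>n. s n \<in> carrier H" and "limitin (htopology H) s l sequentially"
  shows "(\<lambda>n. hnorm H (s n \<oplus> (-1) \<odot> l)) \<longlonglongrightarrow> 0"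
proof -
  have "l \<in> carrier H"
    using assms(2) by (rule metric.limitin_mspace)
  then have "hnorm H (s n \<oplus> (-1) \<odot> l) = hdist H (s n) l" for n
    using assms(1) by (simp add: hdist_eq)
  then show ?thesis
    using assms(2) unfolding metric.limit_metric_sequentially LIMSEQ_def by simp blast
qed

lemma tendsto_hinner:
  assumes s: "\<And>n. s n \<in> carrier H" and l: "limitin (htopology H) s l sequentially"
    and x: "x \<in> carrier H"
  shows "(\<lambda>n. hinner H x (s n)) \<longlonglongrightarrow> hinner H x l"
proof -
  have lc: "l \<in> carrier H"
    using l by (rule metric.limitin_mspace)
  have bound: "cmod (hinner H x (s n) - hinner H x l) \<le> hnorm H x * hnorm H (s n \<oplus> (-1) \<odot> l)" for n
    using cauchy_schwarz[OF x, of "s n \<oplus> (-1) \<odot> l"] x s lc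
    by (simp add: ip_add_right ip_smult_right)
  have "(\<lambda>n. hinner H x (s n) - hinner H x l) \<longlonglongrightarrow> 0"
    by (rule Lim_null_comparison[OF always_eventually[OF allI[OF bound]]
          tendsto_mult_right_zero[OF hdist_limit[OF s l]]])
  then show ?thesis
    by (simp add: LIM_zero_iff)
qed

lemma tendsto_hnorm:
  assumes s: "\<And>n. s n \<in> carrier H" and l: "limitin (htopology H) s l sequentially"
  shows "(\<lambda>n. hnorm H (s n)) \<longlonglongrightarrow> hnorm H l"
proof -
  have lc: "l \<in> carrier H"
    using l by (rule metric.limitin_mspace)
  \<comment> \<open>With the norm as distance to zero, the reverse triangle inequality comes from
    the metric.\<close>
  have hdist_zero: "hnorm H x = hdist H x \<zero>" if "x \<in> carrier H" for x
    using that by (simp add: hdist_eq)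
  have bound: "norm (hnorm H (s n) - hnorm H l) \<le> hdist H (s n) l" for n
    using metric.triangle[of "s n" l \<zero>] metric.triangle[of l "s n" \<zero>] s[of n] lc
    by (simp add: hdist_zero metric.commute[of l "s n"])
  have "(\<lambda>n. hdist H (s n) l) \<longlonglongrightarrow> 0"
    using hdist_limit[OF s l] s lc by (simp add: hdist_eq)
  then have "(\<lambda>n. hnorm H (s n) - hnorm H l) \<longlonglongrightarrow> 0"
    by (rule Lim_null_comparison[OF always_eventually[OF allI[OF bound]]])
  then show ?thesis
    by (simp add: LIM_zero_iff)
qed

section \<open>Density: approximating sequences, separation of points, recovery of the norm\<close>

lemma dense_sequence:
  assumes "dense_in H D" "x \<in> carrier H"
  obtains s where "\<And>n. s n \<in> D" "limitin (htopology H) s x sequentially"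
proof -
  have D: "D \<subseteq> carrier H" and "x \<in> (closure_of) (htopology H) D"
    using assms by (auto simp: dense_in_def)
  then have "\<exists>y\<in>D. hdist H x y < inverse (real (Suc n))" for n
    unfolding metric.metric_closure_of by (force simp: metric.in_mball)
  then obtain s where s: "\<And>n. s n \<in> D" "\<And>n. hdist H x (s n) < inverse (real (Suc n))"
    by metis
  have "\<exists>N. \<forall>n\<ge>N. hdist H (s n) x < e" if "e > 0" for e
  proof -
    obtain N where N: "inverse (real (Suc N)) < e"
      using reals_Archimedean \<open>e > 0\<close> by blast
    have "hdist H (s n) x < e" if "n \<ge> N" for n
    proof -
      have "inverse (real (Suc n)) \<le> inverse (real (Suc N))"
        using that by simp
      then show ?thesis
        using s(2)[of n] N metric.commute[of "s n" x] by linarith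
    qed
    then show ?thesis by blast
  qed
  then have "limitin (htopology H) s x sequentially"
    unfolding metric.limit_metric_sequentially using assms(2) s(1) D by blast
  with s(1) show ?thesis
    by (rule that)
qed

lemma dense_inI_sequence:
  assumes "D \<subseteq> carrier H"
    and "\<And>x. x \<in> carrier H \<Longrightarrow> \<exists>s. (\<forall>n. s n \<in> D) \<and> limitin (htopology H) s x sequentially"
  shows "dense_in H D"
proof -
  have "x \<in> (closure_of) (htopology H) D" if x: "x \<in> carrier H" for x
  proof -
    obtain s where s: "\<forall>n. s n \<in> D" "limitin (htopology H) s x sequentially"
      using assms(2)[OF x] by blast
    then have "s n \<in> (closure_of) (htopology H) D" for n
      using assms(1) by (metis closure_of_subset metric.topspace_mtopology subsetD)
    then show ?thesis
      using s(2) by (intro limitin_closedin[OF s(2) closedin_closure_of]) auto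
  qed
  then show ?thesis
    using assms(1) closure_of_subset_topspace[of "htopology H" D]
    by (auto simp: dense_in_def)
qed

text \<open>The difference \<open>z\<close> is orthogonal to \<open>D\<close>; along a sequence in
  \<open>D\<close> tending to \<open>z\<close> this orthogonality passes to the limit and gives
  \<open>hinner H z z = 0\<close>.\<close>

lemma dense_hinner_eqD:
  assumes D: "dense_in H D" and x: "x \<in> carrier H" and y: "y \<in> carrier H"
    and eq: "\<And>d. d \<in> D \<Longrightarrow> hinner H d x = hinner H d y"
  shows "x = y"
proof -
  define z where "z = x \<oplus> (-1) \<odot> y"
  have z: "z \<in> carrier H"
    using x y by (simp add: z_def)
  obtain s where s: "\<And>n. s n \<in> D" "limitin (htopology H) s z sequentially"
    using dense_sequence[OF D z] by blast
  have sc: "s n \<in> carrier H" for n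
    using s(1) D by (auto simp: dense_in_def)
  have "hinner H z (s n) = 0" for n
    using eq[OF s(1)[of n]] x y sc[of n] z ip_commute[OF sc[of n] z]
    by (simp add: z_def ip_add_right ip_smult_right)
  then have "hinner H z z = 0"
    using tendsto_hinner[OF sc s(2) z] LIMSEQ_unique[of "\<lambda>n. 0" 0] by auto
  then show ?thesis
    using x y by (intro eq_if_hnorm_diff_eq_zero) (simp_all add: z_def hnorm_def)
qed

text \<open>Cauchy-Schwarz gives one inequality. Conversely, the supremum bounds the functional
  \<open>hinner H _ z\<close> on \<open>D\<close>, and along a sequence in \<open>D\<close> tending
  to \<open>z\<close> this bound becomes
  \<open>hnorm H z * hnorm H z \<le> S * hnorm H z\<close>.\<close>

lemma hnorm_eq_SUP:
  assumes D: "dense_in H D" and z: "z \<in> carrier H"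
  shows "ennreal (hnorm H z) =
    (SUP x \<in> D - {\<zero>}. ennreal (cmod (hinner H x z) / hnorm H x))" (is "_ = ?S")
proof (rule antisym)
  have Dc: "D \<subseteq> carrier H"
    using D by (simp add: dense_in_def)
  have le: "cmod (hinner H x z) / hnorm H x \<le> hnorm H z" if "x \<in> D - {\<zero>}" for x
  proof -
    have "x \<in> carrier H"
      using that Dc by auto
    then show ?thesis
      using cauchy_schwarz[of x z] leD[OF hnorm_nonneg[of x]] z
      by (simp add: divide_le_eq mult.commute)
  qed
  then show S_le: "?S \<le> ennreal (hnorm H z)"
    by (intro SUP_least) (simp add: ennreal_leI)
  \<comment> \<open>The supremum is finite by \<open>S_le\<close>, so the rest can be done in the
    reals.\<close>
  define S where "S = enn2real ?S"
  have S: "?S = ennreal S"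
    unfolding S_def using S_le by (metis ennreal_enn2real ennreal_less_top le_less_trans)
  have S0: "S \<ge> 0"
    by (simp add: S_def)
  have bound: "cmod (hinner H x z) \<le> S * hnorm H x" if x: "x \<in> D" for x
  proof (cases "x = \<zero>")
    case True
    then show ?thesis
      using cauchy_schwarz[of x z] x Dc z hnorm_eq_zero_iff[of x] by auto
  next
    case False
    then have "ennreal (cmod (hinner H x z) / hnorm H x) \<le> ennreal S"
      unfolding S[symmetric] using x by (intro SUP_upper) auto
    moreover have "hnorm H x > 0"
      using x Dc False hnorm_eq_zero_iff[of x] hnorm_nonneg[of x] by (auto simp: less_le)
    ultimately show ?thesis
      using S0 by (simp add: divide_le_eq)
  qed
  obtain s where s: "\<And>n. s n \<in> D" "limitin (htopology H) s z sequentially"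
    using dense_sequence[OF D z] by blast
  have sc: "s n \<in> carrier H" for n
    using s(1) Dc by auto
  have "cmod (hinner H z (s n)) \<le> S * hnorm H (s n)" for n
    using bound[OF s(1)[of n]] ip_commute[OF sc[of n] z] by simp
  then have "cmod (hinner H z z) \<le> S * hnorm H z"
    by (intro LIMSEQ_le[OF tendsto_norm[OF tendsto_hinner[OF sc s(2) z]]
          tendsto_mult_left[OF tendsto_hnorm[OF sc s(2)]]]) blast
  then have "hnorm H z * hnorm H z \<le> S * hnorm H z"
    using z by (simp add: ip_self norm_mult power2_eq_square)
  then have "hnorm H z \<le> S"
    using S0 hnorm_nonneg[OF z] by (metis less_le mult_le_cancel_right not_le)
  then show "ennreal (hnorm H z) \<le> ?S"
    unfolding S by (rule ennreal_leI)
qed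

section \<open>Riesz representation and orthogonal projection for submodules\<close>

lemma semi_inner_space_submodule:
  assumes "submodule D complex_ring H"
  shows "semi_inner_space (H\<lparr>carrier := D\<rparr>)"
proof -
  interpret sub: module complex_ring "H\<lparr>carrier := D\<rparr>"
    using submodule.submodule_is_module[OF assms] module_axioms .
  have "D \<subseteq> carrier H"
    by (rule submoduleE(1)[OF assms])
  then show ?thesis
    by unfold_locales (auto simp: subset_iff ip_add_left ip_smult_left ip_nonneg intro: ip_commute)
qed

text \<open>The minimizing sequence is built inside \<open>D\<close> and converges in the complete
  space \<open>H\<close>. It is part of the conclusion because it shows that \<open>u\<close> lies
  in the closure of \<open>D\<close>.\<close>

lemma riesz_submodule:
  assumes D: "submodule D complex_ring H"
    and f_add: "\<And>x y. \<lbrakk>x \<in> D; y \<in> D\<rbrakk> \<Longrightarrow> f (x \<oplus> y) = f x + f y"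
    and f_smult: "\<And>c x. x \<in> D \<Longrightarrow> f (c \<odot> x) = c * f x"
    and f_bound: "\<And>x. x \<in> D \<Longrightarrow> cmod (f x) \<le> C * hnorm H x"
  obtains s u where "\<And>n. s n \<in> D" and "u \<in> carrier H" and "limitin (htopology H) s u sequentially"
    and "\<And>x. x \<in> D \<Longrightarrow> f x = hinner H x u"
proof -
  have Dc: "D \<subseteq> carrier H"
    by (rule submoduleE(1)[OF D])
  interpret sub: semi_inner_space "H\<lparr>carrier := D\<rparr>"
    by (rule semi_inner_space_submodule[OF D])
  obtain s where s: "\<And>n. s n \<in> D"
    and cauchy: "\<And>e. e > 0 \<Longrightarrow> \<exists>N. \<forall>m\<ge>N. \<forall>n\<ge>N. hnorm H (s m \<oplus> (-1) \<odot> s n) < e"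
    and lim: "\<And>x. x \<in> D \<Longrightarrow> (\<lambda>n. hinner H x (s n)) \<longlonglongrightarrow> f x"
    using sub.riesz_sequence[of f C] f_add f_smult f_bound by (auto simp: hnorm_def)
  have sc: "s n \<in> carrier H" for n
    using s Dc by auto
  obtain u where u: "u \<in> carrier H" "limitin (htopology H) s u sequentially"
    using Cauchy_imp_limit[OF sc cauchy] by blast
  have "f x = hinner H x u" if "x \<in> D" for x
    using LIMSEQ_unique[OF lim[OF that] tendsto_hinner[OF sc u(2)]] that Dc by auto
  then show ?thesis
    using that s u by blast
qed

text \<open>Representing \<open>hinner H _ x\<close> on \<open>D\<close> yields the projection
  \<open>u\<close> of \<open>x\<close> onto the closure of \<open>D\<close>. The remainder is
  orthogonal to \<open>D\<close>, hence zero, so \<open>x\<close> itself is a limit of points of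
  \<open>D\<close>.\<close>

lemma dense_inI_orthogonal:
  assumes D: "submodule D complex_ring H"
    and orth: "\<And>x. \<lbrakk>x \<in> carrier H; \<And>d. d \<in> D \<Longrightarrow> hinner H d x = 0\<rbrakk> \<Longrightarrow> x = \<zero>"
  shows "dense_in H D"
proof (rule dense_inI_sequence)
  show Dc: "D \<subseteq> carrier H"
    by (rule submoduleE(1)[OF D])
  fix x assume x: "x \<in> carrier H"
  obtain s u where s: "\<And>n. s n \<in> D" and u: "u \<in> carrier H" "limitin (htopology H) s u sequentially"
    and eq: "\<And>d. d \<in> D \<Longrightarrow> hinner H d x = hinner H d u"
    using riesz_submodule[OF D, of "\<lambda>d. hinner H d x" "hnorm H x"] Dc x
      cauchy_schwarz[OF _ x]
    by (auto simp: subset_iff ip_add_left ip_smult_left mult.commute)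
  have "x \<oplus> (-1) \<odot> u = \<zero>"
    using eq x u(1) Dc by (intro orth) (auto simp: ip_add_right ip_smult_right subset_iff)
  then have "x = u"
    using x u(1) hnorm_eq_zero_iff[of \<zero>] by (intro eq_if_hnorm_diff_eq_zero) auto
  then show "\<exists>s. (\<forall>n. s n \<in> D) \<and> limitin (htopology H) s x sequentially"
    using s u by blast
qed

end

subsection \<open>Closed embeddings and their adjoints\<close>

lemma closed_embeddingD:
  assumes "closed_embedding K H j"
  shows "hilbert_space K" "hilbert_space H" "\<And>x w. (x, w) \<in> j \<longleftrightarrow> x = w \<and> x \<in> Domain j"
    "submodule (Domain j) complex_ring K" "submodule (Domain j) complex_ring H"
    "same_linear_structure_on (Domain j) K H" "dense_in K (Domain j)" "closed_operator K H j"
    "Domain j \<subseteq> carrier K" "Domain j \<subseteq> carrier H"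
  using assms by (auto simp: closed_embedding_def)

lemma same_linear_structure_onD:
  assumes "same_linear_structure_on D K H"
  shows "\<zero>\<^bsub>K\<^esub> = \<zero>\<^bsub>H\<^esub>"
    "\<And>x y. x \<in> D \<Longrightarrow> y \<in> D \<Longrightarrow> x \<oplus>\<^bsub>K\<^esub> y = x \<oplus>\<^bsub>H\<^esub> y"
    "\<And>c x. x \<in> D \<Longrightarrow> c \<odot>\<^bsub>K\<^esub> x = c \<odot>\<^bsub>H\<^esub> x"
  using assms by (auto simp: same_linear_structure_on_def)

section \<open>Adjoints, closed graphs and inverses of embeddings\<close>

lemma adjointI:
  assumes "y \<in> carrier H" "z \<in> carrier K"
    and "\<And>x w. (x, w) \<in> T \<Longrightarrow> hinner H w y = hinner K x z"
  shows "(y, z) \<in> adjoint K H T"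
  using assms by (auto simp: adjoint_def)

lemma adjointD:
  assumes "(y, z) \<in> adjoint K H T"
  shows "y \<in> carrier H" "z \<in> carrier K"
    "\<And>x w. (x, w) \<in> T \<Longrightarrow> hinner H w y = hinner K x z"
  using assms by (auto simp: adjoint_def)

lemma adjoint_linear:
  assumes "hilbert_space K" "hilbert_space H" and T: "T \<subseteq> carrier K \<times> carrier H"
    and yz: "(y, z) \<in> adjoint K H T" "(y', z') \<in> adjoint K H T"
  shows "(y \<oplus>\<^bsub>H\<^esub> c \<odot>\<^bsub>H\<^esub> y', z \<oplus>\<^bsub>K\<^esub> c \<odot>\<^bsub>K\<^esub> z') \<in> adjoint K H T"
proof -
  interpret K: hilbert_space K by fact
  interpret H: hilbert_space H by fact
  show ?thesis
  proof (rule adjointI)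
    fix x w assume xw: "(x, w) \<in> T"
    then have "x \<in> carrier K" "w \<in> carrier H"
      using T by auto
    then show "hinner H w (y \<oplus>\<^bsub>H\<^esub> c \<odot>\<^bsub>H\<^esub> y') = hinner K x (z \<oplus>\<^bsub>K\<^esub> c \<odot>\<^bsub>K\<^esub> z')"
      using adjointD[OF yz(1)] adjointD[OF yz(2)] xw
      by (simp add: H.ip_add_right H.ip_smult_right K.ip_add_right K.ip_smult_right)
  qed (use adjointD[OF yz(1)] adjointD[OF yz(2)] in simp_all)
qed

lemma closed_operator_limit:
  assumes "closed_operator K H T" and "\<And>n. (s n, t n) \<in> T"
    and "limitin (htopology K) s x sequentially" "limitin (htopology H) t y sequentially"
  shows "(x, y) \<in> T"
proof (rule limitin_closedin)
  show "limitin (prod_topology (htopology K) (htopology H)) (\<lambda>n. (s n, t n)) (x, y) sequentially"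
    using assms(3,4) by (simp add: limitin_pairwise comp_def)
qed (use assms(1,2) in \<open>auto simp: closed_operator_def\<close>)

text \<open>The graph of the inverse is the preimage of a closed set under the continuous swap of
  coordinates.\<close>

lemma closed_operator_converse:
  assumes "closed_operator K H T"
  shows "closed_operator H K (T\<inverse>)"
proof -
  have "closedin (prod_topology (htopology H) (htopology K))
    {p \<in> topspace (prod_topology (htopology H) (htopology K)). prod.swap p \<in> T}"
  proof (rule closedin_continuous_map_preimage)
    show "continuous_map (prod_topology (htopology H) (htopology K))
        (prod_topology (htopology K) (htopology H)) prod.swap"
      unfolding prod.swap_def
      by (intro continuous_map_pairedI continuous_map_fst continuous_map_snd)
  qed (use assms in \<open>simp add: closed_operator_def\<close>)
  moreover have "{p \<in> topspace (prod_topology (htopology H) (htopology K)). prod.swap p \<in> T} = T\<inverse>"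
    using closedin_subset[OF assms[unfolded closed_operator_def]] by auto
  ultimately show ?thesis
    by (simp add: closed_operator_def)
qed

text \<open>The inverse is again the identity on the same manifold. Every clause on that manifold is
  symmetric in the two spaces except density, which the second hypothesis supplies in
  \<open>H\<close>.\<close>

lemma closed_embedding_converse:
  assumes "closed_embedding K H j" "dense_in H (Range j)"
  shows "closed_embedding H K (j\<inverse>)"
proof -
  note j = closed_embeddingD[OF assms(1)]
  have "Range j = Domain j" "j\<inverse> = Id_on (Domain j)"
    by (auto simp: j(3))
  moreover have "same_linear_structure_on (Domain j) H K"
    using j(6) by (simp add: same_linear_structure_on_def)
  moreover have "closed_operator H K (j\<inverse>)"
    using j(8) by (rule closed_operator_converse)
  ultimately show ?thesis
    using j(1,2,4,5,9,10) assms(2) unfolding closed_embedding_def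
    by (intro conjI exI[of _ "Domain j"]) auto
qed

text \<open>
  This is \<open>j\<^sup>*\<^sup>* = j\<close>. Subtracting from \<open>(u, w)\<close> its orthogonal projection \<open>(d, d)\<close> onto the
  graph of \<open>j\<close> yields \<open>(a, b)\<close> with \<open>(b, -a)\<close> in the adjoint, which is therefore orthogonal to
  itself. The projection is obtained from the Riesz argument for the graph inner product on the
  domain of \<open>j\<close>.
\<close>

lemma adjoint_adjoint_closed_embedding:
  assumes "closed_embedding K H j"
  shows "adjoint H K (adjoint K H j) \<subseteq> j"
proof (rule subrelI)
  define D where "D = Domain j"
  note j = closed_embeddingD[OF assms, folded D_def]
  interpret K: hilbert_space K by (rule j(1))
  interpret H: hilbert_space H by (rule j(2))
  have DK: "x \<in> carrier K" and DH: "x \<in> carrier H" if "x \<in> D" for x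
    using that j(9,10) by auto
  note same = same_linear_structure_onD[OF j(6)]
  fix u w assume uw: "(u, w) \<in> adjoint H K (adjoint K H j)"
  note u = adjointD(1)[OF uw] and w = adjointD(2)[OF uw] and orth = adjointD(3)[OF uw]

  \<comment> \<open>The graph inner product on \<open>D\<close>. \<open>G\<close> is not shown to be
    complete, so only the sequence from the Riesz argument is used and its limits are taken in
    \<open>K\<close> and \<open>H\<close>.\<close>
  define G where "G = K\<lparr>carrier := D, hinner := \<lambda>x y. hinner K x y + hinner H x y\<rparr>"
  have G_simps [simp]: "carrier G = D" "hinner G x y = hinner K x y + hinner H x y"
    "x \<oplus>\<^bsub>G\<^esub> y = x \<oplus>\<^bsub>K\<^esub> y" "c \<odot>\<^bsub>G\<^esub> x = c \<odot>\<^bsub>K\<^esub> x" for x y c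
    by (simp_all add: G_def)
  have D_add: "x \<oplus>\<^bsub>K\<^esub> y \<in> D" and D_smult: "c \<odot>\<^bsub>K\<^esub> x \<in> D" if "x \<in> D" "y \<in> D" for x y c
    using K.submoduleE(4,5)[OF j(4)] that by simp_all
  have H_add: "hinner H (x \<oplus>\<^bsub>K\<^esub> y) z = hinner H x z + hinner H y z"
    if "x \<in> D" "y \<in> D" "z \<in> carrier H" for x y z
    using that same(2) DH by (simp add: H.ip_add_left)
  have H_smult: "hinner H (c \<odot>\<^bsub>K\<^esub> x) z = c * hinner H x z"
    if "x \<in> D" "z \<in> carrier H" for c x z
    using that same(3) DH by (simp add: H.ip_smult_left)
  have "module complex_ring (K\<lparr>carrier := D\<rparr>)"
    using submodule.submodule_is_module[OF j(4)] K.module_axioms .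
  then have "module complex_ring G"
    by (simp add: G_def module_def module_axioms_def abelian_group_def abelian_monoid_def
        abelian_group_axioms_def)
  then interpret G: semi_inner_space G
  proof (intro semi_inner_space.intro semi_inner_space_axioms.intro)
    show "hinner G y x = cnj (hinner G x y)" if "x \<in> carrier G" "y \<in> carrier G" for x y
      using that K.ip_commute[of x y] H.ip_commute[of x y] DK DH by simp
  qed (auto simp: DK DH H_add H_smult K.ip_add_left K.ip_smult_left K.ip_nonneg H.ip_nonneg
      distrib_left)
  \<comment> \<open>A Cauchy sequence for the graph norm is therefore Cauchy in both spaces.\<close>
  have G_norm: "hnorm K x \<le> hnorm G x" "hnorm H x \<le> hnorm G x" if "x \<in> D" for x
    using that K.ip_nonneg[of x] H.ip_nonneg[of x] DK DH by (auto simp: hnorm_def)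

  \<comment> \<open>The inner product of \<open>(x, x)\<close> with \<open>(u, w)\<close> in the
    product of \<open>K\<close> and \<open>H\<close>.\<close>
  define f where "f x = hinner K x u + hinner H x w" for x
  have f_bound: "cmod (f x) \<le> (hnorm K u + hnorm H w) * hnorm G x" if x: "x \<in> D" for x
  proof -
    have "cmod (f x) \<le> hnorm K x * hnorm K u + hnorm H x * hnorm H w"
      unfolding f_def using K.cauchy_schwarz[OF DK[OF x] u] H.cauchy_schwarz[OF DH[OF x] w]
      by (intro norm_triangle_le) linarith
    also have "\<dots> \<le> hnorm G x * hnorm K u + hnorm G x * hnorm H w"
      using x u w by (intro add_mono mult_right_mono G_norm) auto
    finally show ?thesis
      by (simp add: algebra_simps)
  qed
  obtain s where s: "\<And>n. s n \<in> D"
    and cauchy: "\<And>e. e > 0 \<Longrightarrow> \<exists>N. \<forall>m\<ge>N. \<forall>n\<ge>N. hnorm G (s m \<oplus>\<^bsub>K\<^esub> (-1) \<odot>\<^bsub>K\<^esub> s n) < e"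
    and lim: "\<And>x. x \<in> D \<Longrightarrow> (\<lambda>n. hinner K x (s n) + hinner H x (s n)) \<longlonglongrightarrow> f x"
  proof (rule G.riesz_sequence[of f "hnorm K u + hnorm H w"])
    show "f (x \<oplus>\<^bsub>G\<^esub> y) = f x + f y" if "x \<in> carrier G" "y \<in> carrier G" for x y
      using that u w by (simp add: f_def K.ip_add_left H_add DK)
    show "f (c \<odot>\<^bsub>G\<^esub> x) = c * f x" if "x \<in> carrier G" for x c
      using that u w by (simp add: f_def K.ip_smult_left H_smult DK distrib_left)
  qed (use f_bound in auto)
  have diff: "s m \<oplus>\<^bsub>K\<^esub> (-1) \<odot>\<^bsub>K\<^esub> s n \<in> D"
    "s m \<oplus>\<^bsub>H\<^esub> (-1) \<odot>\<^bsub>H\<^esub> s n = s m \<oplus>\<^bsub>K\<^esub> (-1) \<odot>\<^bsub>K\<^esub> s n" for m n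
    using D_add[OF s D_smult[OF s s]] same(2)[OF s D_smult[OF s s]] same(3)[OF s] by auto
  have "\<exists>N. \<forall>m\<ge>N. \<forall>n\<ge>N. hnorm K (s m \<oplus>\<^bsub>K\<^esub> (-1) \<odot>\<^bsub>K\<^esub> s n) < e" if "e > 0" for e
    using cauchy[OF that] G_norm(1)[OF diff(1)] by (meson le_less_trans)
  then obtain d where d: "d \<in> carrier K" "limitin (htopology K) s d sequentially"
    using K.Cauchy_imp_limit[of s] s DK by blast
  have "\<exists>N. \<forall>m\<ge>N. \<forall>n\<ge>N. hnorm H (s m \<oplus>\<^bsub>H\<^esub> (-1) \<odot>\<^bsub>H\<^esub> s n) < e" if "e > 0" for e
    using cauchy[OF that] G_norm(2)[OF diff(1)] unfolding diff(2) by (meson le_less_trans)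
  then obtain d' where d': "d' \<in> carrier H" "limitin (htopology H) s d' sequentially"
    using H.Cauchy_imp_limit[of s] s DH by blast
  \<comment> \<open>Closedness of the graph forces the two limits to be the same point of
    \<open>D\<close>.\<close>
  have "(d, d') \<in> j"
    by (rule closed_operator_limit[OF j(8) _ d(2) d'(2)]) (use s in \<open>simp add: j(3)\<close>)
  then have "d' = d" and dD: "d \<in> D"
    by (auto simp: j(3))
  \<comment> \<open>\<open>(d, d)\<close> represents \<open>f\<close>, so \<open>(u, w)\<close>
    minus \<open>(d, d)\<close> is orthogonal to the graph.\<close>
  have proj: "hinner K x u + hinner H x w = hinner K x d + hinner H x d" if x: "x \<in> D" for x
    using LIMSEQ_unique[OF lim[OF x] tendsto_add[OF
        K.tendsto_hinner[OF _ d(2) DK[OF x]] H.tendsto_hinner[OF _ d'(2) DH[OF x]]]]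
      s DK DH \<open>d' = d\<close> by (simp add: f_def)

  define a where "a = u \<oplus>\<^bsub>K\<^esub> (-1) \<odot>\<^bsub>K\<^esub> d"
  define b where "b = w \<oplus>\<^bsub>H\<^esub> (-1) \<odot>\<^bsub>H\<^esub> d"
  have a: "a \<in> carrier K" and b: "b \<in> carrier H"
    using u w DK[OF dD] DH[OF dD] by (simp_all add: a_def b_def)
  have ab: "hinner H x b = hinner K x ((-1) \<odot>\<^bsub>K\<^esub> a)" if x: "x \<in> D" for x
    using proj[OF x] u w DK[OF x] DH[OF x] DK[OF dD] DH[OF dD] a
    by (simp add: a_def b_def K.ip_add_right K.ip_smult_right H.ip_add_right H.ip_smult_right
        algebra_simps)
  have "(b, (-1) \<odot>\<^bsub>K\<^esub> a) \<in> adjoint K H j"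
    using ab a b by (intro adjointI) (auto simp: j(3))
  then have bw: "hinner K ((-1) \<odot>\<^bsub>K\<^esub> a) u = hinner H b w"
    by (rule orth)
  have bd: "hinner H b d = hinner K ((-1) \<odot>\<^bsub>K\<^esub> a) d"
    using ab[OF dD] H.ip_commute[OF DH[OF dD] b] K.ip_commute[OF DK[OF dD], of "(-1) \<odot>\<^bsub>K\<^esub> a"] a
    by simp
  \<comment> \<open>Only the second argument is expanded, here and for \<open>a\<close> below;
    \<open>(2)\<close> and \<open>(4)\<close> count occurrences.\<close>
  have "hinner H b b = hinner H b w - hinner H b d"
    using b w DH[OF dD] by (subst (2) b_def) (simp add: H.ip_add_right H.ip_smult_right)
  also have "\<dots> = - (hinner K a u - hinner K a d)"
    using bw bd a u DK[OF dD] by (simp add: K.ip_smult_left)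
  also have "hinner K a u - hinner K a d = hinner K a a"
    using a u DK[OF dD] by (subst (4) a_def) (simp add: K.ip_add_right K.ip_smult_right)
  finally have "(hnorm H b)\<^sup>2 + (hnorm K a)\<^sup>2 = 0"
    using a b by (simp add: H.hnorm_square K.hnorm_square)
  then have "hnorm K a = 0" "hnorm H b = 0"
    by (simp_all add: sum_power2_eq_zero_iff)
  then have "u = d" "w = d"
    using K.eq_if_hnorm_diff_eq_zero[OF u d(1)] H.eq_if_hnorm_diff_eq_zero[OF w DH[OF dD]]
    by (simp_all add: a_def b_def)
  then show "(u, w) \<in> j"
    using dD by (simp add: j(3))
qed

text \<open>If \<open>z\<close> is orthogonal to the range, then \<open>(z, 0)\<close> lies in the
  double adjoint and so in \<open>j\<close>; as \<open>j\<close> acts as the identity,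
  \<open>z\<close> is zero.\<close>

lemma range_adjoint_dense:
  assumes "closed_embedding K H j"
  shows "dense_in K (Range (adjoint K H j))"
proof -
  note j = closed_embeddingD[OF assms]
  interpret K: hilbert_space K by (rule j(1))
  interpret H: hilbert_space H by (rule j(2))
  have jc: "j \<subseteq> carrier K \<times> carrier H"
    using j(9,10) by (auto simp: j(3))
  note lin = adjoint_linear[OF j(1,2) jc]
  \<comment> \<open>Taken as the first pair in \<open>lin\<close>, the zero pair turns closure under
    \<open>y + c y'\<close> into closure under multiples.\<close>
  have zero: "(\<zero>\<^bsub>H\<^esub>, \<zero>\<^bsub>K\<^esub>) \<in> adjoint K H j"
  proof (rule adjointI)
    fix x w assume "(x, w) \<in> j"
    then have "x \<in> carrier K" "w \<in> carrier H"
      using jc by auto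
    then show "hinner H w \<zero>\<^bsub>H\<^esub> = hinner K x \<zero>\<^bsub>K\<^esub>"
      using H.ip_smult_right[of "\<zero>\<^bsub>H\<^esub>" w 0] K.ip_smult_right[of "\<zero>\<^bsub>K\<^esub>" x 0]
        H.smult_r_null[of 0] K.smult_r_null[of 0]
      by simp
  qed auto
  have sub: "Range (adjoint K H j) \<subseteq> carrier K"
    by (auto dest: adjointD)
  have smult: "c \<odot>\<^bsub>K\<^esub> z \<in> Range (adjoint K H j)" if z: "z \<in> Range (adjoint K H j)" for c z
  proof -
    obtain y where "(y, z) \<in> adjoint K H j"
      using z by blast
    from lin[OF zero this, of c] have "\<zero>\<^bsub>K\<^esub> \<oplus>\<^bsub>K\<^esub> c \<odot>\<^bsub>K\<^esub> z \<in> Range (adjoint K H j)"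
      by blast
    then show ?thesis
      using z sub by (simp add: subset_iff)
  qed
  have "submodule (Range (adjoint K H j)) complex_ring K"
  proof (rule K.submoduleI[OF sub])
    show "\<ominus>\<^bsub>K\<^esub> z \<in> Range (adjoint K H j)" if "z \<in> Range (adjoint K H j)" for z
      using smult[OF that, of "-1"] K.minus_eq_smult[OF subsetD[OF sub that]] by simp
    show "z \<oplus>\<^bsub>K\<^esub> z' \<in> Range (adjoint K H j)"
      if z: "z \<in> Range (adjoint K H j)" "z' \<in> Range (adjoint K H j)" for z z'
    proof -
      obtain y y' where "(y, z) \<in> adjoint K H j" "(y', z') \<in> adjoint K H j"
        using z by blast
      from lin[OF this, of 1] have "z \<oplus>\<^bsub>K\<^esub> 1 \<odot>\<^bsub>K\<^esub> z' \<in> Range (adjoint K H j)"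
        by blast
      then show ?thesis
        using z sub K.smult_one by (auto simp: subset_iff)
    qed
  qed (use zero smult in auto)
  then show ?thesis
  proof (rule K.dense_inI_orthogonal)
    fix z assume z: "z \<in> carrier K"
      and orth: "\<And>d. d \<in> Range (adjoint K H j) \<Longrightarrow> hinner K d z = 0"
    have "(z, \<zero>\<^bsub>H\<^esub>) \<in> adjoint H K (adjoint K H j)"
    proof (rule adjointI)
      fix y v assume yv: "(y, v) \<in> adjoint K H j"
      then show "hinner K v z = hinner H y \<zero>\<^bsub>H\<^esub>"
        using orth[of v] adjointD(1)[OF yv] H.ip_smult_right[of "\<zero>\<^bsub>H\<^esub>" y 0] H.smult_r_null[of 0]
        by auto
    qed (use z in auto)
    then have "(z, \<zero>\<^bsub>H\<^esub>) \<in> j"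
      using adjoint_adjoint_closed_embedding[OF assms] by blast
    then show "z = \<zero>\<^bsub>K\<^esub>"
      using same_linear_structure_onD(1)[OF j(6)] by (simp add: j(3))
  qed
qed

text \<open>A finite supremum makes \<open>hinner H _ y\<close> a functional on
  \<open>Domain j\<close> bounded in the norm of \<open>K\<close>; its Riesz vector is the value of
  the adjoint at \<open>y\<close>.\<close>

lemma domain_adjoint_if_SUP_finite:
  assumes "closed_embedding K H j" and y: "y \<in> carrier H"
    and fin: "(SUP x \<in> Domain j - {\<zero>\<^bsub>K\<^esub>}. ennreal (cmod (hinner H x y) / hnorm K x)) = ennreal C"
    and "C \<ge> 0"
  shows "y \<in> Domain (adjoint K H j)"
proof -
  note j = closed_embeddingD[OF assms(1)]
  interpret K: hilbert_space K by (rule j(1))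
  interpret H: hilbert_space H by (rule j(2))
  note same = same_linear_structure_onD[OF j(6)]
  have DK: "x \<in> carrier K" and DH: "x \<in> carrier H" if "x \<in> Domain j" for x
    using that j(9,10) by auto
  have bound: "cmod (hinner H x y) \<le> C * hnorm K x" if x: "x \<in> Domain j" for x
  proof (cases "x = \<zero>\<^bsub>K\<^esub>")
    \<comment> \<open>Zero is left out of the supremum; there both norms vanish because the two
      spaces share their zero.\<close>
    case True
    then have "hnorm H x = 0" "hnorm K x = 0"
      using same(1) H.hnorm_eq_zero_iff[OF DH[OF x]] K.hnorm_eq_zero_iff[OF DK[OF x]] by simp_all
    then show ?thesis
      using H.cauchy_schwarz[OF DH[OF x] y] by simp
  next
    case False
    then have "ennreal (cmod (hinner H x y) / hnorm K x) \<le> ennreal C"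
      unfolding fin[symmetric] using x by (intro SUP_upper) auto
    moreover have "hnorm K x > 0"
      using False K.hnorm_eq_zero_iff[OF DK[OF x]] K.hnorm_nonneg[OF DK[OF x]] by (simp add: less_le)
    ultimately show ?thesis
      using \<open>C \<ge> 0\<close> by (simp add: divide_le_eq)
  qed
  obtain u where u: "u \<in> carrier K" "\<And>x. x \<in> Domain j \<Longrightarrow> hinner H x y = hinner K x u"
  proof (rule K.riesz_submodule[OF j(4), of "\<lambda>x. hinner H x y" C])
    show "hinner H (x \<oplus>\<^bsub>K\<^esub> x') y = hinner H x y + hinner H x' y"
      if "x \<in> Domain j" "x' \<in> Domain j" for x x'
      using same(2)[OF that] that DH y by (simp add: H.ip_add_left)
    show "hinner H (c \<odot>\<^bsub>K\<^esub> x) y = c * hinner H x y" if "x \<in> Domain j" for c x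
      using same(3)[OF that] that DH y by (simp add: H.ip_smult_left)
  qed (use bound in auto)
  have "(y, u) \<in> adjoint K H j"
  proof (rule adjointI[OF y u(1)])
    fix x w assume "(x, w) \<in> j"
    then have "w = x" "x \<in> Domain j"
      by (auto simp: j(3))
    then show "hinner H w y = hinner K x u"
      using u(2) by simp
  qed
  then show ?thesis
    by blast
qed

subsection \<open>Triplets\<close>

locale hilbert_triplet =
  fixes Hp H0 Hm :: "'a hspace" and jp jm :: "'a rel"
  assumes triplet: "triplet_with Hp H0 Hm jp jm"
begin

lemma closed_embeddings: "closed_embedding Hp H0 jp" "closed_embedding H0 Hm jm"
  and dense_ranges: "dense_in H0 (Range jp)" "dense_in Hm (Range jm)"
  and domain_adjoint_subset: "Domain (adjoint Hp H0 jp) \<subseteq> Domain jm"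
  and hnorm_minus_eq: "\<And>y. y \<in> Domain jm \<Longrightarrow> ennreal (hnorm Hm y) =
    (SUP x \<in> Domain jp - {\<zero>\<^bsub>Hp\<^esub>}. ennreal (cmod (hinner H0 x y) / hnorm Hp x))"
  using triplet by (auto simp: triplet_with_def)

lemmas jp = closed_embeddingD[OF closed_embeddings(1)]
lemmas jm = closed_embeddingD[OF closed_embeddings(2)]
lemmas same_m = same_linear_structure_onD[OF jm(6)]

sublocale Hp: hilbert_space Hp by (rule jp(1))
sublocale H0: hilbert_space H0 by (rule jp(2))
sublocale Hm: hilbert_space Hm by (rule jm(2))

section \<open>The adjoint \<open>T\<close> as a linear isometry from the norm of \<open>Hm\<close>
  to that of \<open>Hp\<close>\<close>

abbreviation T :: "'a rel"
  where "T \<equiv> adjoint Hp H0 jp"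

lemma Range_eq_Domain: "Range jp = Domain jp" "Range jm = Domain jm"
  by (auto simp: jp(3) jm(3))

lemma T_hinner: "\<lbrakk>(y, z) \<in> T; x \<in> Domain jp\<rbrakk> \<Longrightarrow> hinner H0 x y = hinner Hp x z"
  by (rule adjointD(3)) (assumption, rule jp(3)[THEN iffD2], blast)

lemma Domain_T: "Domain T = Domain jm"
proof
  show "Domain jm \<subseteq> Domain T"
  proof
    fix y assume y: "y \<in> Domain jm"
    have "y \<in> carrier Hm" "y \<in> carrier H0"
      using y jm(9,10) by auto
    then show "y \<in> Domain T"
      using domain_adjoint_if_SUP_finite[OF closed_embeddings(1) _ hnorm_minus_eq[OF y, symmetric]]
      by simp
  qed
qed (rule domain_adjoint_subset)

lemma T_cases:
  assumes "x \<in> Domain jm"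
  obtains r where "(x, r) \<in> T"
  using assms Domain_T by blast

lemma T_carrier:
  assumes "(x, r) \<in> T"
  shows "x \<in> Domain jm" "x \<in> carrier H0" "x \<in> carrier Hm" "r \<in> carrier Hp"
  using adjointD(1,2)[OF assms] domain_adjoint_subset assms jm(10) by auto

text \<open>Moving \<open>jp\<close> across the inner product turns the supremum for the norm of
  \<open>y\<close> in \<open>Hm\<close> into one of \<open>hinner Hp x z\<close> over the dense set
  \<open>Domain jp\<close>, which recovers the norm of \<open>z\<close>.\<close>

lemma hnorm_T: "(y, z) \<in> T \<Longrightarrow> hnorm Hm y = hnorm Hp z"
proof -
  assume yz: "(y, z) \<in> T"
  have "ennreal (hnorm Hm y) =
      (SUP x \<in> Domain jp - {\<zero>\<^bsub>Hp\<^esub>}. ennreal (cmod (hinner Hp x z) / hnorm Hp x))"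
    unfolding hnorm_minus_eq[OF T_carrier(1)[OF yz]]
    using T_hinner[OF yz] by (intro SUP_cong) auto
  also have "\<dots> = ennreal (hnorm Hp z)"
    using Hp.hnorm_eq_SUP[OF jp(7) T_carrier(4)[OF yz]] by simp
  finally show ?thesis
    using T_carrier[OF yz] by simp
qed

text \<open>The adjoint is linear for the operations of \<open>H0\<close>, and these agree with
  those of \<open>Hm\<close> on \<open>Domain jm\<close>.\<close>

lemma T_linear:
  assumes "(y, z) \<in> T" "(y', z') \<in> T"
  shows "(y \<oplus>\<^bsub>Hm\<^esub> c \<odot>\<^bsub>Hm\<^esub> y', z \<oplus>\<^bsub>Hp\<^esub> c \<odot>\<^bsub>Hp\<^esub> z') \<in> T"
proof -
  note y = T_carrier(1)[OF assms(1)] and y' = T_carrier(1)[OF assms(2)]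
  have "c \<odot>\<^bsub>H0\<^esub> y' \<in> Domain jm"
    using H0.submoduleE(4)[OF jm(4)] y' by simp
  then have "y \<oplus>\<^bsub>Hm\<^esub> c \<odot>\<^bsub>Hm\<^esub> y' = y \<oplus>\<^bsub>H0\<^esub> c \<odot>\<^bsub>H0\<^esub> y'"
    using y y' same_m(2,3) by metis
  moreover have "jp \<subseteq> carrier Hp \<times> carrier H0"
    using jp(9,10) by (auto simp: jp(3))
  ultimately show ?thesis
    using adjoint_linear[OF jp(1,2) _ assms] by simp
qed

text \<open>Polarization: comparing the norms of \<open>y + c y'\<close> and
  \<open>z + c z'\<close>, the choice \<open>c = 1\<close> gives the real part and
  \<open>c = \<i>\<close> the imaginary part.\<close>

lemma hinner_T:
  assumes yz: "(y, z) \<in> T" "(y', z') \<in> T"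
  shows "hinner Hm y y' = hinner Hp z z'"
proof -
  have "Re (cnj c * hinner Hm y y') = Re (cnj c * hinner Hp z z')" for c
    using hnorm_T[OF T_linear[OF yz, of c]] hnorm_T[OF yz(1)] hnorm_T[OF yz(2)]
      Hm.hnorm_square_add_smult[OF T_carrier(3)[OF yz(1)] T_carrier(3)[OF yz(2)], of c]
      Hp.hnorm_square_add_smult[OF T_carrier(4)[OF yz(1)] T_carrier(4)[OF yz(2)], of c]
    by (simp only:)
  from this[of 1] this[of \<i>] show ?thesis
    by (simp add: complex_eq_iff)
qed

lemma dense_Range_T: "dense_in Hp (Range T)"
  using range_adjoint_dense[OF closed_embeddings(1)] .

section \<open>The reversed triplet and its kernel operator\<close>

lemma T_adjoint_jm_converse:
  assumes "(y, w) \<in> adjoint Hm H0 (jm\<inverse>)" "x \<in> Domain jm"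
  shows "hinner H0 x y = hinner Hm x w"
  using assms by (intro adjointD(3)[OF assms(1)]) (simp add: jm(3))

text \<open>This is the domain inclusion for the reversed triplet. The vector \<open>w\<close> may
  lie outside \<open>Domain jm\<close>, so \<open>T\<close> is extended to it by continuity: the
  limit \<open>u\<close> of \<open>T\<close> along \<open>s\<close> exists because \<open>T\<close>
  is isometric.\<close>

lemma adjoint_jm_converse_subset: "Domain (adjoint Hm H0 (jm\<inverse>)) \<subseteq> Domain jp"
proof
  fix y assume "y \<in> Domain (adjoint Hm H0 (jm\<inverse>))"
  then obtain w where yw: "(y, w) \<in> adjoint Hm H0 (jm\<inverse>)"
    by blast
  note y = adjointD(1)[OF yw] and w = adjointD(2)[OF yw]
  obtain s where s: "\<And>n. s n \<in> Domain jm" "limitin (htopology Hm) s w sequentially"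
    using Hm.dense_sequence[OF dense_ranges(2) w] Range_eq_Domain by metis
  have sm: "s n \<in> carrier Hm" for n
    using s(1) jm(10) by auto
  have "\<exists>r. (s n, r) \<in> T" for n
    by (rule T_cases[OF s(1)]) (rule exI)
  then obtain t where st: "\<And>n. (s n, t n) \<in> T"
    by metis
  note t = T_carrier(4)[OF st]
  have cauchy: "\<exists>N. \<forall>m\<ge>N. \<forall>n\<ge>N. hnorm Hp (t m \<oplus>\<^bsub>Hp\<^esub> (-1) \<odot>\<^bsub>Hp\<^esub> t n) < e" if "e > 0" for e
    using Hm.limit_imp_Cauchy[OF sm s(2) that] by (simp add: hnorm_T[OF T_linear[OF st st]])
  obtain u where u: "u \<in> carrier Hp" "limitin (htopology Hp) t u sequentially"
    by (rule Hp.Cauchy_imp_limit[OF t cauchy])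
  \<comment> \<open>For \<open>r = T x\<close>, the inner product of \<open>r\<close> and
    \<open>u\<close> in \<open>Hp\<close> equals that of \<open>x\<close> and \<open>w\<close> in
    \<open>Hm\<close>, hence that of \<open>x\<close> and \<open>y\<close> in \<open>H0\<close>. So
    \<open>u\<close> is in the domain of the double adjoint, and \<open>u = y\<close>
    follows.\<close>
  have "(u, y) \<in> adjoint H0 Hp T"
  proof (rule adjointI[OF u(1) y])
    fix x r assume xr: "(x, r) \<in> T"
    have "(\<lambda>n. hinner Hp r (t n)) \<longlonglongrightarrow> hinner Hm x w"
      using Hm.tendsto_hinner[OF sm s(2) T_carrier(3)[OF xr]] by (simp add: hinner_T[OF xr st])
    then have "hinner Hp r u = hinner Hm x w"
      using LIMSEQ_unique Hp.tendsto_hinner[OF t u(2) T_carrier(4)[OF xr]] by blast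
    then show "hinner Hp r u = hinner H0 x y"
      using T_adjoint_jm_converse[OF yw T_carrier(1)[OF xr]] by simp
  qed
  then have "(u, y) \<in> jp"
    using adjoint_adjoint_closed_embedding[OF closed_embeddings(1)] by blast
  then show "y \<in> Domain jp"
    by (auto simp: jp(3))
qed

lemma hinner_jp_T: "\<lbrakk>(x, r) \<in> T; y \<in> Domain jp\<rbrakk> \<Longrightarrow> hinner H0 x y = hinner Hp r y"
  using T_hinner[of x r y] H0.ip_commute[of y x] Hp.ip_commute[of y r] T_carrier[of x r] jp(9,10)
  by (auto simp: subset_iff)

text \<open>\<open>T\<close> maps \<open>Domain jm\<close> onto its range, preserves norms, and
  carries pairing with \<open>y\<close> in \<open>H0\<close> to pairing with \<open>y\<close> in
  \<open>Hp\<close>. The supremum thus runs over the dense range of \<open>T\<close>.\<close>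

lemma hnorm_plus_eq:
  assumes y: "y \<in> Domain jp"
  shows "ennreal (hnorm Hp y) =
    (SUP x \<in> Domain jm - {\<zero>\<^bsub>Hm\<^esub>}. ennreal (cmod (hinner H0 x y) / hnorm Hm x))"
proof -
  define g where "g r = ennreal (cmod (hinner Hp r y) / hnorm Hp r)" for r
  define h where "h x = ennreal (cmod (hinner H0 x y) / hnorm Hm x)" for x
  \<comment> \<open>Norm preservation makes the excluded zeros correspond.\<close>
  have eq: "h x = g r" and zero: "x = \<zero>\<^bsub>Hm\<^esub> \<longleftrightarrow> r = \<zero>\<^bsub>Hp\<^esub>" if xr: "(x, r) \<in> T" for x r
    using hinner_jp_T[OF xr y] hnorm_T[OF xr] Hm.hnorm_eq_zero_iff[OF T_carrier(3)[OF xr]]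
      Hp.hnorm_eq_zero_iff[OF T_carrier(4)[OF xr]]
    by (simp_all add: g_def h_def)
  have "h ` (Domain jm - {\<zero>\<^bsub>Hm\<^esub>}) = g ` (Range T - {\<zero>\<^bsub>Hp\<^esub>})"
  proof (intro equalityI image_subsetI)
    fix x assume x: "x \<in> Domain jm - {\<zero>\<^bsub>Hm\<^esub>}"
    then have "x \<in> Domain jm"
      by simp
    then obtain r where "(x, r) \<in> T"
      by (rule T_cases)
    then show "h x \<in> g ` (Range T - {\<zero>\<^bsub>Hp\<^esub>})"
      using x eq zero by blast
  next
    fix r assume r: "r \<in> Range T - {\<zero>\<^bsub>Hp\<^esub>}"
    then obtain x where xr: "(x, r) \<in> T"
      by blast
    then show "g r \<in> h ` (Domain jm - {\<zero>\<^bsub>Hm\<^esub>})"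
      using r zero T_carrier(1) by (auto simp flip: eq[OF xr])
  qed
  moreover have "ennreal (hnorm Hp y) = Sup (g ` (Range T - {\<zero>\<^bsub>Hp\<^esub>}))"
    using Hp.hnorm_eq_SUP[OF dense_Range_T, of y] y jp(9) by (auto simp: g_def)
  ultimately show ?thesis
    by (simp add: h_def)
qed

text \<open>Inversion exchanges the density of domains, built into closed embeddings, with the
  density of ranges required by the triplet.\<close>

lemma triplet_converse: "triplet_with Hm H0 Hp (jm\<inverse>) (jp\<inverse>)"
  unfolding triplet_with_def
proof (intro conjI ballI)
  show "closed_embedding Hm H0 (jm\<inverse>)" "closed_embedding H0 Hp (jp\<inverse>)"
    using closed_embeddings dense_ranges by (auto intro: closed_embedding_converse)
  show "dense_in H0 (Range (jm\<inverse>))" "dense_in Hp (Range (jp\<inverse>))"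
    using jm(7) jp(7) by simp_all
  show "Domain (adjoint Hm H0 (jm\<inverse>)) \<subseteq> Domain (jp\<inverse>)"
    using adjoint_jm_converse_subset Range_eq_Domain by simp
  show "ennreal (hnorm Hp y) = (SUP x \<in> Domain (jm\<inverse>) - {\<zero>\<^bsub>Hm\<^esub>}.
      ennreal (cmod (hinner H0 x y) / hnorm Hm x))" if "y \<in> Domain (jp\<inverse>)" for y
    using hnorm_plus_eq that Range_eq_Domain by simp
qed

lemma kernel_operator_converse:
  "kernel_operator Hm H0 (jm\<inverse>) = (kernel_operator Hp H0 jp)\<inverse>"
proof -
  \<comment> \<open>Since \<open>jp\<close> and \<open>jm\<close> are restrictions of the identity,
    each composition is an adjoint restricted to those pairs whose value lies in the domain of the
    embedding.\<close>
  have "(y, z) \<in> adjoint Hm H0 (jm\<inverse>) \<and> z \<in> Domain jm \<longleftrightarrow> (z, y) \<in> T \<and> y \<in> Domain jp" for y z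
  proof (intro iffI conjI; elim conjE)
    assume yz: "(y, z) \<in> adjoint Hm H0 (jm\<inverse>)" and z: "z \<in> Domain jm"
    show y: "y \<in> Domain jp"
      using yz adjoint_jm_converse_subset by blast
    obtain v where zv: "(z, v) \<in> T"
      using z by (rule T_cases)
    \<comment> \<open>Both vectors have the same inner products with the dense range of
      \<open>T\<close>, the passage going through \<open>Hm\<close> and \<open>H0\<close>.\<close>
    have "v = y"
    proof (rule Hp.dense_hinner_eqD[OF dense_Range_T T_carrier(4)[OF zv]])
      show "y \<in> carrier Hp"
        using y jp(9) by auto
      fix r assume "r \<in> Range T"
      then obtain x where xr: "(x, r) \<in> T"
        by blast
      show "hinner Hp r v = hinner Hp r y"
        using hinner_T[OF xr zv] hinner_jp_T[OF xr y] T_adjoint_jm_converse[OF yz T_carrier(1)[OF xr]]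
        by simp
    qed
    then show "(z, y) \<in> T"
      using zv by simp
  next
    assume zy: "(z, y) \<in> T" and y: "y \<in> Domain jp"
    show "z \<in> Domain jm"
      using zy by (rule T_carrier)
    show "(y, z) \<in> adjoint Hm H0 (jm\<inverse>)"
    proof (rule adjointI)
      fix x w assume "(x, w) \<in> jm\<inverse>"
      then have "w = x" and "x \<in> Domain jm"
        by (auto simp: jm(3))
      moreover from this(2) obtain r where xr: "(x, r) \<in> T"
        by (rule T_cases)
      ultimately show "hinner H0 w y = hinner Hm x z"
        using hinner_T[OF xr zy] hinner_jp_T[OF xr y] by simp
    qed (use y jp(10) T_carrier(3)[OF zy] in auto)
  qed
  then show ?thesis
    by (auto simp: kernel_operator_def jp(3) jm(3) relcomp_unfold)
qed

end

theorem proposition5p3: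
  fixes Hp H0 Hm :: "'a hspace" and jp jm :: "'a rel"
  assumes "triplet_with Hp H0 Hm jp jm"
  shows "triplet Hm H0 Hp \<and>
    triplet_with Hm H0 Hp (jm\<inverse>) (jp\<inverse>) \<and>
    hamiltonian Hm H0 (jm\<inverse>) = kernel_operator Hp H0 jp \<and>
    kernel_operator Hm H0 (jm\<inverse>) = hamiltonian Hp H0 jp"
proof -
  interpret hilbert_triplet Hp H0 Hm jp jm
    by unfold_locales (fact assms)
  show ?thesis
    \<comment> \<open>The Hamiltonian is the converse of the kernel operator, so one identity yields
      both exchanges.\<close>
    using triplet_converse kernel_operator_converse
    by (auto simp: triplet_def hamiltonian_def)
qed

end
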